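(* For every natural number $m\ge 2$, there exists a finite simple graph $G$ such that its Randić energy satisfies $RE(G)=m$.
   Context: For a finite simple graph $G$ with vertices $v_1,\dots,v_n$ of degrees $d_1,\dots,d_n$, the Randić matrix $R(G)$ is the $n\times n$ real symmetric matrix with $(i,j)$-entry $\frac{1}{\sqrt{d_id_j}}$ if $v_i$ and $v_j$ are adjacent, and $0$ otherwise. The Randić energy of $G$ is $RE(G)=\sum_{i=1}^n|\rho_i|$, where $\rho_1,\dots,\rho_n$ are the eigenvalues of $R(G)$ counted with multiplicity. *)

theory Defs
  imports "Graph_Theory.Pair_Digraph" "Jordan_Normal_Form.Char_Poly"
begin

text \<open>
  A finite simple graph is a \<open>pair_graph\<close>: a finite symmetric loop-free digraph whose arcs
  are pairs of vertices. An edge \<open>uv\<close> is the pair of arcs \<open>(u, v)\<close> and \<open>(v, u)\<close>, so the degree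
  of \<open>v\<close> is its out-degree. The vertices are listed in increasing order; the spectrum does not
  depend on the order chosen.
\<close>

definition randic_matrix :: "'a::linorder pair_pre_digraph \<Rightarrow> real mat" where
  "randic_matrix G =
     (let vs = sorted_list_of_set (pverts G); n = card (pverts G) in
      mat n n (\<lambda>(i, j).
        if (vs ! i, vs ! j) \<in> parcs G
        then 1 / sqrt (real (out_degree (with_proj G) (vs ! i)) * real (out_degree (with_proj G) (vs ! j)))
        else 0))"

text \<open>
  The matrix is real symmetric, so all of its eigenvalues are real and it is enough to sum over
  the real ones. The multiplicity is that of a root of the characteristic polynomial.
\<close>

definition randic_energy :: "'a::linorder pair_pre_digraph \<Rightarrow> real" where
  "randic_energy G =
     (\<Sum>\<rho> | eigenvalue (randic_matrix G) \<rho>.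
        real (order \<rho> (char_poly (randic_matrix G))) * \<bar>\<rho>\<bar>)"

end

theory Submission
  imports Defs
begin

text \<open>
  The friendship graph of \<open>n\<close> triangles sharing one vertex has Randic energy \<open>n + 1\<close>. Its Randic
  matrix \<open>A\<close> satisfies \<open>A\<^sup>2 = I/4 + 3/4 v v\<^sup>T\<close>, where \<open>v\<close> is the unit eigenvector for the eigenvalue
  \<open>1\<close>. For the characteristic polynomial \<open>\<chi>\<close> of \<open>A\<close>, the product \<open>\<chi>(x) \<chi>(-x)\<close> is up to sign the
  determinant of \<open>x\<^sup>2 I - A\<^sup>2\<close>, a rank-one perturbation of a scalar matrix, hence equals
  \<open>-(x\<^sup>2 - 1) (x\<^sup>2 - 1/4)\<^bsup>2n\<^esup>\<close>. So the absolute values of the eigenvalues are \<open>1\<close> (once) and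
  \<open>1/2\<close> (\<open>2n\<close> times).
\<close>

section \<open>Rank-one perturbations of scalar matrices\<close>

text \<open>Both sides are evaluations of the bordered determinant of \<open>?M\<close>: the
  factorisation \<open>?L * ?R\<close> takes the Schur complement of the corner \<open>1\<close>,
  and multiplying by \<open>?S\<close> instead clears the block \<open>U\<close>. The factor
  \<open>c\<close> is \<open>det ?S\<close>; keeping it on the left avoids division and covers
  \<open>c = 0\<close>.\<close>

lemma det_scalar_minus_rank_one:
  fixes U V :: "'a :: idom mat"
  assumes U: "U \<in> carrier_mat n 1" and V: "V \<in> carrier_mat 1 n"
  shows "c * det (c \<cdot>\<^sub>m 1\<^sub>m n - U * V) = (c - (V * U) $$ (0, 0)) * c ^ n"
proof -
  let ?C = "c \<cdot>\<^sub>m 1\<^sub>m n"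
  let ?M = "four_block_mat (1\<^sub>m 1) V U ?C"
  let ?L = "four_block_mat (1\<^sub>m 1) (0\<^sub>m 1 n) U (1\<^sub>m n)"
  let ?R = "four_block_mat (1\<^sub>m 1) V (0\<^sub>m n 1) (?C - U * V)"
  let ?S = "four_block_mat (c \<cdot>\<^sub>m 1\<^sub>m 1) (0\<^sub>m 1 n) (- U) (1\<^sub>m n)"
  let ?T = "four_block_mat (c \<cdot>\<^sub>m 1\<^sub>m 1 - V * U) V (0\<^sub>m n 1) ?C"
  have UV: "U * V \<in> carrier_mat n n" and VU: "V * U \<in> carrier_mat 1 1"
    using U V by auto
  have carrier: "?M \<in> carrier_mat (1 + n) (1 + n)" "?L \<in> carrier_mat (1 + n) (1 + n)"
    "?R \<in> carrier_mat (1 + n) (1 + n)" "?S \<in> carrier_mat (1 + n) (1 + n)"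
    using U V UV by (auto intro!: four_block_carrier_mat)
  have "?L * ?R = ?M"
  proof -
    have "?L * ?R = four_block_mat (1\<^sub>m 1 * 1\<^sub>m 1 + 0\<^sub>m 1 n * 0\<^sub>m n 1)
        (1\<^sub>m 1 * V + 0\<^sub>m 1 n * (?C - U * V)) (U * 1\<^sub>m 1 + 1\<^sub>m n * 0\<^sub>m n 1)
        (U * V + 1\<^sub>m n * (?C - U * V))"
      by (rule mult_four_block_mat) (use U V UV in auto)
    also have "\<dots> = ?M"
    proof -
      have "W + 1\<^sub>m n * (?C - W) = ?C" if "W \<in> carrier_mat n n" for W
        using that by (subst left_mult_one_mat[of _ n n]) (auto intro!: eq_matI)
      from this[OF UV] have "U * V + 1\<^sub>m n * (?C - U * V) = ?C" .
      then show ?thesis using U V UV by simp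
    qed
    finally show ?thesis .
  qed
  then have "det ?M = det ?L * det ?R"
    using det_mult[OF carrier(2,3)] by simp
  also have "det ?L = 1"
    by (subst det_four_block_mat_upper_right_zero[of _ 1 _ n]) (use U in auto)
  also have "det ?R = det (?C - U * V)"
    using det_four_block_mat_lower_left_zero[OF one_carrier_mat V refl minus_carrier_mat[OF UV]]
    by simp
  finally have M1: "det ?M = det (?C - U * V)" by simp
  have "?M * ?S = ?T"
  proof -
    have "?M * ?S = four_block_mat (1\<^sub>m 1 * (c \<cdot>\<^sub>m 1\<^sub>m 1) + V * (- U))
        (1\<^sub>m 1 * 0\<^sub>m 1 n + V * 1\<^sub>m n) (U * (c \<cdot>\<^sub>m 1\<^sub>m 1) + ?C * (- U))
        (U * 0\<^sub>m 1 n + ?C * 1\<^sub>m n)"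
      by (rule mult_four_block_mat) (use U V in auto)
    also have "1\<^sub>m 1 * (c \<cdot>\<^sub>m 1\<^sub>m 1) + V * (- U) = c \<cdot>\<^sub>m 1\<^sub>m 1 - V * U"
      using U V by (intro eq_matI) auto
    also have "1\<^sub>m 1 * 0\<^sub>m 1 n + V * 1\<^sub>m n = V" using V by simp
    also have "U * (c \<cdot>\<^sub>m 1\<^sub>m 1) + ?C * (- U) = 0\<^sub>m n 1"
    proof -
      have "U * (c \<cdot>\<^sub>m 1\<^sub>m 1) = c \<cdot>\<^sub>m U"
        using U by (subst mult_smult_distrib[of _ n 1 _ 1]) auto
      moreover have "?C * (- U) = c \<cdot>\<^sub>m (- U)"
        using U by (subst mult_smult_assoc_mat[of _ n n _ 1]) auto
      ultimately show ?thesis using U by (intro eq_matI) auto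
    qed
    also have "U * 0\<^sub>m 1 n + ?C * 1\<^sub>m n = ?C" using U by simp
    finally show ?thesis .
  qed
  then have "det ?M * det ?S = det ?T"
    using det_mult[OF carrier(1,4)] by simp
  moreover have "det ?S = c"
    by (subst det_four_block_mat_upper_right_zero[of _ 1 _ n]) (use U in auto)
  moreover have "det ?T = (c - (V * U) $$ (0, 0)) * c ^ n"
    using det_four_block_mat_lower_left_zero[OF minus_carrier_mat[OF VU] V refl, of ?C]
      U V det_single[OF minus_carrier_mat[OF VU]] by simp
  ultimately show ?thesis using M1 by (simp add: mult.commute)
qed

section \<open>Reflected characteristic polynomials and root multiplicities\<close>

text \<open>Split off the full power of \<open>x + a\<close> from \<open>p\<close>. Reflection turns
  \<open>x + a\<close> into \<open>-(x - a)\<close>, and the reflected cofactor does not vanish at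
  \<open>a\<close>.\<close>

lemma order_pcompose_uminus:
  fixes p :: "'a :: idom poly"
  assumes "p \<noteq> 0"
  shows "order a (pcompose p [:0, -1:]) = order (- a) p"
proof -
  let ?r = "[:0, -1:] :: 'a poly"
  obtain q where q: "p = [:a, 1:] ^ order (- a) p * q" "\<not> [:a, 1:] dvd q"
    using order_decomp[OF assms, of "- a"] by auto
  define k where "k = order (- a) p"
  have nz: "poly q (- a) \<noteq> 0" using q(2) by (simp add: poly_eq_0_iff_dvd)
  have "pcompose p ?r = [:a, -1:] ^ k * pcompose q ?r"
    by (subst q(1)) (simp add: pcompose_mult pcompose_hom.hom_power k_def pcompose_pCons)
  also have "[:a, -1:] = - [:- a, 1:]" by simp
  also have "(- [:- a, 1:]) ^ k = Polynomial.smult ((- 1) ^ k) ([:- a, 1:] ^ k)"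
    by (metis smult_1_left smult_minus_left smult_power)
  finally have eq: "pcompose p ?r = Polynomial.smult ((- 1) ^ k) ([:- a, 1:] ^ k * pcompose q ?r)"
    by simp
  have nz': "poly (pcompose q ?r) a \<noteq> 0" using nz by (simp add: poly_pcompose)
  then have "[:- a, 1:] ^ k * pcompose q ?r \<noteq> 0" by auto
  then show ?thesis
    using nz' by (simp add: eq order_smult order_mult order_power_n_n order_0I k_def)
qed

lemma order_diff_squares:
  fixes s :: real
  assumes "s \<noteq> 0"
  shows "order s [:- s\<^sup>2, 0, 1:] = 1" "order (- s) [:- s\<^sup>2, 0, 1:] = 1"
proof -
  have eq: "[:- s\<^sup>2, 0, 1:] = [:- s, 1:] * [:s, 1:]"
    by (simp add: power2_eq_square)
  have 1: "order s [:- s, 1:] = 1" "order (- s) [:s, 1:] = 1"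
    using order_power_n_n[of s 1] order_power_n_n[of "- s" 1] by auto
  have 0: "order s [:s, 1:] = 0" "order (- s) [:- s, 1:] = 0"
    using assms by (auto intro!: order_0I)
  have "[:- s, 1:] * [:s, 1:] \<noteq> 0" by (simp only: mult_eq_0_iff) simp
  then show "order s [:- s\<^sup>2, 0, 1:] = 1" "order (- s) [:- s\<^sup>2, 0, 1:] = 1"
    unfolding eq using 0 1 by (simp_all add: order_mult del: mult_pCons_left mult_pCons_right)
qed

text \<open>Factor \<open>x^2 I - A^2\<close> as \<open>(x I - A) (x I + A)\<close>; the sign arises
  because the second factor is the negative of \<open>(-x) I - A\<close>.\<close>

lemma char_poly_mult_reflected:
  fixes A :: "'a :: field mat"
  assumes A: "A \<in> carrier_mat N N"
  shows "poly (char_poly A) x * poly (char_poly A) (- x) =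
    (- 1) ^ N * det (x\<^sup>2 \<cdot>\<^sub>m 1\<^sub>m N - A * A)"
proof -
  let ?P = "x \<cdot>\<^sub>m 1\<^sub>m N - A" and ?Q = "x \<cdot>\<^sub>m 1\<^sub>m N + A"
  have PQ: "?P \<in> carrier_mat N N" "?Q \<in> carrier_mat N N" using A by auto
  have "- char_matrix A x = ?P"
    using A by (intro eq_matI) (auto simp: char_matrix_def)
  then have p: "poly (char_poly A) x = det ?P"
    by (simp add: char_poly_matrix[OF A])
  have "- char_matrix A (- x) = (- 1) \<cdot>\<^sub>m ?Q"
    using A by (intro eq_matI) (auto simp: char_matrix_def)
  then have q: "poly (char_poly A) (- x) = (- 1) ^ N * det ?Q"
    using A by (simp add: char_poly_matrix[OF A])
  have "?P * ?Q = x\<^sup>2 \<cdot>\<^sub>m 1\<^sub>m N - A * A"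
  proof -
    have xx: "x \<cdot>\<^sub>m 1\<^sub>m N \<in> carrier_mat N N" by simp
    have 1: "(x \<cdot>\<^sub>m 1\<^sub>m N) * B = x \<cdot>\<^sub>m B" if "B \<in> carrier_mat N N" for B
      using that by (subst mult_smult_assoc_mat[of _ N N _ N]) auto
    have 2: "A * (x \<cdot>\<^sub>m 1\<^sub>m N) = x \<cdot>\<^sub>m A"
      using A by (subst mult_smult_distrib[of _ N N _ N]) auto
    have "?P * ?Q = (x \<cdot>\<^sub>m 1\<^sub>m N) * ?Q - A * ?Q"
      by (rule minus_mult_distrib_mat[OF xx A PQ(2)])
    also have "A * ?Q = x \<cdot>\<^sub>m A + A * A"
      using mult_add_distrib_mat[OF A xx A] 2 by simp
    finally have "?P * ?Q = x \<cdot>\<^sub>m ?Q - (x \<cdot>\<^sub>m A + A * A)"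
      using 1[OF PQ(2)] by simp
    then show ?thesis
      using A by (auto intro!: eq_matI simp: power2_eq_square algebra_simps)
  qed
  then have "det ?P * det ?Q = det (x\<^sup>2 \<cdot>\<^sub>m 1\<^sub>m N - A * A)"
    using det_mult[OF PQ] by simp
  then show ?thesis unfolding p q by (simp add: mult.left_commute mult.assoc)
qed

text \<open>
  The identity for \<open>\<chi>(x) \<chi>(-x)\<close> only determines the sums of the multiplicities of \<open>\<rho>\<close> and
  \<open>-\<rho>\<close>, but the sum of the absolute values of the eigenvalues depends on nothing more.
\<close>

lemma sum_abs_eigenvalues_of_square_rank_one:
  fixes A U V :: "real mat"
  assumes A: "A \<in> carrier_mat N N" and U: "U \<in> carrier_mat N 1" and V: "V \<in> carrier_mat 1 N"
    and sq: "A * A = s\<^sup>2 \<cdot>\<^sub>m 1\<^sub>m N + U * V" and VU: "(V * U) $$ (0, 0) = t\<^sup>2 - s\<^sup>2"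
    and st: "s > 0" "t > 0" "s \<noteq> t"
  shows "(\<Sum>\<rho> | eigenvalue A \<rho>. real (order \<rho> (char_poly A)) * \<bar>\<rho>\<bar>) = t + (real N - 1) * s"
proof -
  define p where "p = char_poly A"
  define q where "q = pcompose p [:0, -1:]"
  let ?S = "[:- s\<^sup>2, 0, 1:]" and ?T = "[:- t\<^sup>2, 0, 1:]"
  have monic: "degree p = N" "coeff p N = 1"
    using degree_monic_char_poly[OF A] by (auto simp: p_def)
  then have p0: "p \<noteq> 0" by auto
  have q0: "q \<noteq> 0" using p0 by (simp add: q_def pcompose_eq_0_iff)
  \<comment> \<open>The extra factor \<open>?S\<close> on the left is the \<open>c\<close> of the
    determinant lemma at \<open>c = x^2 - s^2\<close>; it avoids the exponent
    \<open>N - 1\<close>.\<close>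
  have key: "?S * (p * q) = Polynomial.smult ((- 1) ^ N) (?T * ?S ^ N)"
  proof (subst poly_eq_poly_eq_iff[symmetric], rule ext)
    fix x
    have "x\<^sup>2 \<cdot>\<^sub>m 1\<^sub>m N - A * A = (x\<^sup>2 - s\<^sup>2) \<cdot>\<^sub>m 1\<^sub>m N - U * V"
      unfolding sq using U V by (intro eq_matI) (auto simp: algebra_simps)
    then have "(x\<^sup>2 - s\<^sup>2) * (poly p x * poly q x) =
        (- 1) ^ N * ((x\<^sup>2 - s\<^sup>2) * det ((x\<^sup>2 - s\<^sup>2) \<cdot>\<^sub>m 1\<^sub>m N - U * V))"
      using char_poly_mult_reflected[OF A, of x] by (simp add: p_def q_def poly_pcompose)
    then show "poly (?S * (p * q)) x = poly (Polynomial.smult ((- 1) ^ N) (?T * ?S ^ N)) x"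
      unfolding det_scalar_minus_rank_one[OF U V] VU
      by (simp add: poly_power power2_eq_square algebra_simps)
  qed
  have nz: "?S * (p * q) \<noteq> 0" "?T * ?S ^ N \<noteq> 0" "p * q \<noteq> 0" "?S ^ N \<noteq> 0"
    using p0 q0 by (auto simp del: mult_pCons_left mult_pCons_right)
  have "order a ?S + (order a p + order a q) = order a ?T + N * order a ?S" for a
  proof -
    have "order a (?S ^ N) = N * order a ?S"
      by (induction N) (simp_all add: order_mult del: mult_pCons_left)
    then show ?thesis
      using arg_cong[OF key, of "order a"] nz
      by (simp add: order_smult order_mult del: mult_pCons_left mult_pCons_right)
  qed
  then have ord: "order a ?S + (order a p + order (- a) p) = order a ?T + N * order a ?S" for a
    using order_pcompose_uminus[OF p0] by (simp add: q_def)
  have "t\<^sup>2 \<noteq> s\<^sup>2" using st by (auto simp: power2_eq_iff)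
  then have ord0: "order t ?S = 0" "order s ?T = 0"
    by (auto intro!: order_0I simp: power2_eq_square)
  have ordt: "order t p + order (- t) p = 1"
    using ord[of t] order_diff_squares[of t] ord0 st by simp
  \<comment> \<open>The summand \<open>1\<close> is the order of \<open>s\<close> in the extra
    factor \<open>?S\<close>.\<close>
  have ords: "1 + (order s p + order (- s) p) = N"
    using ord[of s] order_diff_squares[of s] ord0 st by simp
  have roots: "a \<in> {t, - t, s, - s}" if "poly p a = 0" for a
  proof -
    have "poly (Polynomial.smult ((- 1) ^ N) (?T * ?S ^ N)) a = 0"
      using that unfolding key[symmetric] by simp
    then have "a\<^sup>2 = t\<^sup>2 \<or> a\<^sup>2 = s\<^sup>2"
      by (auto simp: poly_power power2_eq_square)
    then show ?thesis by (auto simp: power2_eq_iff)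
  qed
  \<comment> \<open>Not all four candidates need be eigenvalues; those that are not have order
    \<open>0\<close> and contribute nothing.\<close>
  have "(\<Sum>\<rho> | eigenvalue A \<rho>. real (order \<rho> p) * \<bar>\<rho>\<bar>) =
      (\<Sum>\<rho> \<in> {t, - t, s, - s}. real (order \<rho> p) * \<bar>\<rho>\<bar>)"
    by (rule sum.mono_neutral_left)
      (use roots p0 in \<open>auto simp: eigenvalue_root_char_poly[OF A] order_root simp flip: p_def\<close>)
  also have "\<dots> = real (order t p + order (- t) p) * t + real (order s p + order (- s) p) * s"
    using st by (subst sum.insert; simp)+ (simp add: algebra_simps)
  also have "real (order s p + order (- s) p) = real N - 1"
    using ords by linarith
  finally show ?thesis unfolding ordt by (simp add: p_def)
qed

section \<open>The friendship graph\<close>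

text \<open>
  Vertex \<open>0\<close> is the centre; the triangles are \<open>{0, 2k - 1, 2k}\<close> for \<open>1 \<le> k \<le> n\<close>. The value
  \<open>partner 0 = 0\<close> has no meaning.
\<close>

definition partner :: "nat \<Rightarrow> nat" where
  "partner i = (if odd i then i + 1 else i - 1)"

definition friendship_graph :: "nat \<Rightarrow> nat pair_pre_digraph" where
  "friendship_graph n = \<lparr> pverts = {..2 * n},
     parcs = {(i, j). i \<le> 2 * n \<and> j \<le> 2 * n \<and>
       (if i = 0 then j \<noteq> 0 else j = 0 \<or> j = partner i)} \<rparr>"

lemma partner_partner: "i > 0 \<Longrightarrow> partner (partner i) = i"
  and partner_pos: "i > 0 \<Longrightarrow> partner i > 0"
  and partner_neq: "i > 0 \<Longrightarrow> partner i \<noteq> i"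
  and partner_le: "i \<le> 2 * n \<Longrightarrow> partner i \<le> 2 * n"
  unfolding partner_def by presburger+

lemma partner_eq_iff: "i > 0 \<Longrightarrow> j > 0 \<Longrightarrow> partner i = j \<longleftrightarrow> i = partner j"
  using partner_partner by metis

lemma pair_graph_friendship_graph: "pair_graph (friendship_graph n)"
proof
  let ?G = "friendship_graph n"
  show "finite (pverts ?G)" by (simp add: friendship_graph_def)
  have "parcs ?G \<subseteq> {..2 * n} \<times> {..2 * n}" by (auto simp: friendship_graph_def)
  then show "finite (parcs ?G)" by (rule finite_subset) simp
  show "symmetric (with_proj ?G)"
    by (auto simp: symmetric_def sym_def friendship_graph_def partner_partner split: if_splits)
  show "fst e \<in> pverts ?G" "snd e \<in> pverts ?G" "fst e \<noteq> snd e" if "e \<in> parcs ?G" for e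
    using that partner_neq[of "fst e"] by (auto simp: friendship_graph_def split: if_splits)
qed

lemma out_degree_friendship_graph:
  assumes "i \<le> 2 * n"
  shows "out_degree (with_proj (friendship_graph n)) i = (if i = 0 then 2 * n else 2)"
proof (cases "i = 0")
  case True
  then have "out_arcs (with_proj (friendship_graph n)) i = Pair 0 ` {1..2 * n}"
    by (auto simp: friendship_graph_def out_arcs_def)
  then show ?thesis using True by (simp add: out_degree_def card_image inj_on_def)
next
  case False
  then have "out_arcs (with_proj (friendship_graph n)) i = {(i, 0), (i, partner i)}"
    using assms partner_le by (auto simp: friendship_graph_def out_arcs_def)
  then show ?thesis using False partner_pos[of i] by (simp add: out_degree_def)
qed

lemma randic_matrix_friendship_graph:
  assumes "n > 0"
  shows "randic_matrix (friendship_graph n) = mat (2 * n + 1) (2 * n + 1) (\<lambda>(i, j).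
    if i = 0 \<and> j = 0 then 0 else if i = 0 \<or> j = 0 then 1 / (2 * sqrt (real n))
    else if j = partner i then 1 / 2 else 0)"
proof -
  have vs: "sorted_list_of_set {..2 * n} = [0..<2 * n + 1]"
    by (metis atLeast_upt lessThan_Suc_atMost Suc_eq_plus1 sorted_list_of_set_range
        atLeast0LessThan)
  \<comment> \<open>The product of the degrees \<open>2 * n\<close> of the centre and
    \<open>2\<close> of an outer vertex, in either order.\<close>
  have sqrt4: "sqrt (2 * (2 * real n)) = 2 * sqrt (real n)"
    "sqrt (2 * real n * 2) = 2 * sqrt (real n)"
    using real_sqrt_mult[of 4 "real n"] by simp_all
  have v: "sorted_list_of_set (pverts (friendship_graph n)) = [0..<2 * n + 1]"
    "card (pverts (friendship_graph n)) = 2 * n + 1"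
    using vs by (simp_all add: friendship_graph_def)
  show ?thesis
    unfolding randic_matrix_def Let_def v
  proof (rule cong_mat[OF refl refl], goal_cases)
    case (1 i j)
    then have "[0..<2 * n + 1] ! i = i" "[0..<2 * n + 1] ! j = j" "i \<le> 2 * n" "j \<le> 2 * n"
      by (simp_all del: upt_Suc)
    moreover from this have "(i, j) \<in> parcs (friendship_graph n) \<longleftrightarrow>
        (if i = 0 then j \<noteq> 0 else j = 0 \<or> j = partner i)"
      by (simp add: friendship_graph_def)
    ultimately show ?case
      using partner_pos[of i] sqrt4
      by (simp add: out_degree_friendship_graph del: upt_Suc)
  qed
qed

theorem randic_energy_friendship_graph:
  assumes n: "n > 0"
  shows "randic_energy (friendship_graph n) = real n + 1"
proof -
  let ?N = "2 * n + 1"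
  let ?A = "randic_matrix (friendship_graph n)"
  define r where "r = 1 / (2 * sqrt (real n))"
  \<comment> \<open>The eigenvector for \<open>1\<close> is proportional to the square roots of the
    degrees. Here it is scaled to squared norm \<open>3/4\<close>, so that \<open>U * V\<close>
    absorbs the coefficient of the rank-one term.\<close>
  define w where "w i = (if i = 0 then 1 / 2 else r)" for i :: nat
  define a where "a i j = (if i = 0 \<and> j = 0 then 0 else if i = 0 \<or> j = 0 then r
    else if j = partner i then 1 / 2 else 0)" for i j
  define U where "U = mat ?N 1 (\<lambda>(i, _). w i)"
  define V where "V = mat 1 ?N (\<lambda>(_, j). w j)"
  have rr: "r * r = 1 / (4 * real n)" using n by (simp add: r_def)
  have A: "?A = mat ?N ?N (\<lambda>(i, j). a i j)"
    unfolding randic_matrix_friendship_graph[OF n] a_def r_def ..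
  have tail: "{0..<?N} = insert 0 {1..2 * n}" by auto
  have "?A * ?A = (1 / 2)\<^sup>2 \<cdot>\<^sub>m 1\<^sub>m ?N + U * V"
  proof (rule eq_matI)
    fix i j
    assume "i < dim_row ((1 / 2)\<^sup>2 \<cdot>\<^sub>m 1\<^sub>m ?N + U * V)" "j < dim_col ((1 / 2)\<^sup>2 \<cdot>\<^sub>m 1\<^sub>m ?N + U * V)"
    then have ij: "i < ?N" "j < ?N" by (auto simp: U_def V_def)
    have "(?A * ?A) $$ (i, j) = (\<Sum>k = 0..<?N. a i k * a k j)"
      using ij by (simp add: A scalar_prod_def)
    also have "\<dots> = a i 0 * a 0 j + (\<Sum>k = 1..2 * n. a i k * a k j)"
      unfolding tail by (subst sum.insert) auto
    also have "\<dots> = (if i = j then 1 / 4 else 0) + w i * w j"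
    proof (cases "i = 0")
      case i: True
      show ?thesis
      proof (cases "j = 0")
        case True
        then have "(\<Sum>k = 1..2 * n. a i k * a k j) = (\<Sum>k = 1..2 * n. r * r)"
          using i by (intro sum.cong) (auto simp: a_def)
        also have "\<dots> = 1 / 2" using n by (simp add: rr)
        finally show ?thesis using i True by (simp add: a_def w_def)
      next
        case False
        \<comment> \<open>The only walk of length two from the centre to \<open>j\<close> goes
          through the partner of \<open>j\<close>.\<close>
        then have "(\<Sum>k = 1..2 * n. a i k * a k j) =
            (\<Sum>k = 1..2 * n. if k = partner j then r / 2 else 0)"
          using i by (intro sum.cong) (auto simp: a_def partner_eq_iff partner_partner)
        also have "\<dots> = r / 2"
          using False ij partner_pos[of j] partner_le[of j n] by simp
        finally show ?thesis using i False by (simp add: a_def w_def)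
      qed
    next
      case i: False
      \<comment> \<open>The only outer neighbour of \<open>i\<close> is its partner, from which a
        step leads to the centre (weight \<open>r\<close>) or back to \<open>i\<close> (weight
        \<open>1/2\<close>).\<close>
      then have "(\<Sum>k = 1..2 * n. a i k * a k j) =
          (\<Sum>k = 1..2 * n. if k = partner i then a k j / 2 else 0)"
        by (intro sum.cong) (auto simp: a_def)
      also have "\<dots> = a (partner i) j / 2"
        using i ij partner_pos[of i] partner_le[of i n] by simp
      finally show ?thesis
        using i partner_pos[of i] by (auto simp: a_def w_def partner_partner)
    qed
    also have "\<dots> = ((1 / 2)\<^sup>2 \<cdot>\<^sub>m 1\<^sub>m ?N + U * V) $$ (i, j)"
      using ij by (simp add: U_def V_def scalar_prod_def power2_eq_square)
    finally show "(?A * ?A) $$ (i, j) = ((1 / 2)\<^sup>2 \<cdot>\<^sub>m 1\<^sub>m ?N + U * V) $$ (i, j)" .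
  qed (auto simp: A U_def V_def)
  moreover have "(V * U) $$ (0, 0) = 1\<^sup>2 - (1 / 2)\<^sup>2"
  proof -
    have "(V * U) $$ (0, 0) = (\<Sum>k = 0..<?N. w k * w k)"
      by (simp add: U_def V_def scalar_prod_def)
    also have "\<dots> = w 0 * w 0 + (\<Sum>k = 1..2 * n. w k * w k)"
      unfolding tail by (subst sum.insert) auto
    also have "(\<Sum>k = 1..2 * n. w k * w k) = (\<Sum>k = 1..2 * n. r * r)"
      by (intro sum.cong) (auto simp: w_def)
    finally show ?thesis using n by (simp add: w_def rr power2_eq_square)
  qed
  \<comment> \<open>With \<open>s = 1/2\<close> and \<open>t = 1\<close> the sum is
    \<open>1 + 2 * n * (1/2)\<close>.\<close>
  ultimately show ?thesis
    unfolding randic_energy_def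
    by (subst sum_abs_eigenvalues_of_square_rank_one[of _ ?N U V "1 / 2" 1])
      (auto simp: A U_def V_def)
qed

theorem corollary1:
  fixes m :: nat
  assumes "m \<ge> 2"
  shows "\<exists>G :: nat pair_pre_digraph. pair_graph G \<and> randic_energy G = real m"
proof (intro exI conjI)
  \<comment> \<open>Since \<open>n\<close> triangles give energy \<open>n + 1\<close>, take
    \<open>m - 1\<close> of them; \<open>m \<ge> 2\<close> makes this number positive.\<close>
  show "pair_graph (friendship_graph (m - 1))"
    by (rule pair_graph_friendship_graph)
  show "randic_energy (friendship_graph (m - 1)) = real m"
    using assms randic_energy_friendship_graph[of "m - 1"] by (simp add: of_nat_diff)
qed

end
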